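(* Let $k\ge 1$ be an integer and let $S_{k,k}$ be the double star graph. Then there is no perfect state transfer (at any time) from one vertex of degree $k+1$ to the other.
   Context: Graphs are finite, simple and undirected. $S_{k,k}$ is the graph obtained from two disjoint copies of the star $K_{1,k}$ by joining the two centers (of degree $k$) by a new edge; the two central vertices have degree $k+1$ and all others have degree one. For distinct vertices $a,b$ of a graph with adjacency matrix $A$ and $U(t)=\exp(itA)$, there is perfect state transfer from $a$ to $b$ at time $\tau\in\mathbb{R}$ if $U(\tau)e_a=\gamma e_b$ for some complex number $\gamma$ (necessarily $|\gamma|=1$), where $e_a$ denotes the standard basis vector indexed by $a$. *)

theory Defs
  imports
    Complex_Main
    "Graph_Theory.Pair_Digraph"
    "Jordan_Normal_Form.Jordan_Normal_Form"
begin

text \<open>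
  A simple undirected graph is a \<^locale>\<open>pair_graph\<close>: every edge is represented by its two
  opposite arcs, so the degree of a vertex is its \<^const>\<open>out_degree\<close>.
\<close>

text \<open>
  The star \<open>K\<^bsub>1,k\<^esub>\<close> is placed twice, with centres \<open>0\<close> and \<open>k + 1\<close> and with leaves
  \<open>1, \<dots>, k\<close> and \<open>k + 2, \<dots>, 2 k + 1\<close> respectively.
\<close>

definition star_arcs :: "nat \<Rightarrow> nat \<Rightarrow> nat rel" where
  "star_arcs c k = {(c, c + i) | i. i \<in> {1..k}}"

definition double_star :: "nat \<Rightarrow> nat pair_pre_digraph" where
  "double_star k =
    (let E = star_arcs 0 k \<union> star_arcs (k + 1) k \<union> {(0, k + 1)}
     in \<lparr> pverts = {0..<2 * (k + 1)}, parcs = E \<union> E\<inverse> \<rparr>)"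

text \<open>Matrices are indexed by \<open>0, 1, \<dots>\<close>; the vertex set is meant to be \<open>{0..<n}\<close>.\<close>

definition adjacency_mat :: "nat pair_pre_digraph \<Rightarrow> complex mat" where
  "adjacency_mat G =
    (let n = card (pverts G) in mat n n (\<lambda>(u, v). if (u, v) \<in> parcs G then 1 else 0))"

text \<open>
  For a square matrix, each of these entrywise series converges; see
  \<open>summable_exp_mat\<close> below.
\<close>

definition exp_mat :: "complex mat \<Rightarrow> complex mat" where
  "exp_mat A = mat (dim_row A) (dim_row A) (\<lambda>(i, j). \<Sum>m. (A ^\<^sub>m m) $$ (i, j) / fact m)"

definition transition_mat :: "nat pair_pre_digraph \<Rightarrow> real \<Rightarrow> complex mat" where
  "transition_mat G t = exp_mat ((\<i> * complex_of_real t) \<cdot>\<^sub>m adjacency_mat G)"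

text \<open>Meant for distinct vertices \<open>a\<close>, \<open>b\<close> of a graph \<open>G\<close> with vertex set \<open>{0..<n}\<close>.\<close>

definition perfect_state_transfer ::
    "nat pair_pre_digraph \<Rightarrow> nat \<Rightarrow> nat \<Rightarrow> real \<Rightarrow> bool" where
  "perfect_state_transfer G a b \<tau> \<longleftrightarrow>
    (let n = card (pverts G)
     in \<exists>\<gamma> :: complex. transition_mat G \<tau> *\<^sub>v unit_vec n a = \<gamma> \<cdot>\<^sub>v unit_vec n b)"

lemma summable_exp_mat:
  assumes A: "A \<in> carrier_mat n n" and "i < n" "j < n"
  shows "summable (\<lambda>m. (A ^\<^sub>m m) $$ (i, j) / (fact m :: complex))"
proof -
  obtain b where b: "norm_bound A b"
    using norm_bound_max by blast
  define c where "c = b * real n"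
  have bound: "norm_bound (A ^\<^sub>m m) (c ^ m)" for m
  proof (induction m)
    case 0
    show ?case using A by (auto simp: norm_bound_def)
  next
    case (Suc m)
    have "norm_bound (A ^\<^sub>m m * A) (c ^ m * b * of_nat n)"
      using norm_bound_mult[OF pow_carrier_mat[OF A] A Suc.IH b] .
    then show ?case by (simp add: c_def mult_ac)
  qed
  show ?thesis
  proof (rule summable_comparison_test')
    show "summable (\<lambda>m. c ^ m /\<^sub>R fact m)"
      by (rule summable_exp_generic)
    show "norm ((A ^\<^sub>m m) $$ (i, j) / (fact m :: complex)) \<le> c ^ m /\<^sub>R fact m" if "m \<ge> 0" for m
    proof -
      have "norm ((A ^\<^sub>m m) $$ (i, j)) \<le> c ^ m"
        using bound[of m] A assms(2,3) pow_carrier_mat[OF A, of m]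
        unfolding norm_bound_def by (metis carrier_matD)
      then show ?thesis
        by (simp add: norm_mult norm_inverse divide_inverse_commute mult_left_mono)
    qed
  qed
qed

lemma double_star_arcs_iff:
  "(u, v) \<in> parcs (double_star k) \<longleftrightarrow>
     u = 0 \<and> v \<in> {1..k + 1} \<or> v = 0 \<and> u \<in> {1..k + 1} \<or>
     u = k + 1 \<and> v \<in> {k + 2..2 * k + 1} \<or> v = k + 1 \<and> u \<in> {k + 2..2 * k + 1}"
proof -
  have shift: "(\<exists>i. x = Suc (k + i) \<and> Suc 0 \<le> i \<and> i \<le> k) \<longleftrightarrow> k + 2 \<le> x \<and> x \<le> 2 * k + 1" for x
    by (rule iffI, force, rule exI[of _ "x - Suc k"], force)
  show ?thesis
    by (auto simp: double_star_def star_arcs_def Let_def shift)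
qed

lemma pair_graph_double_star: "pair_graph (double_star k)"
proof -
  have verts: "pverts (double_star k) = {0..<2 * (k + 1)}"
    by (simp add: double_star_def Let_def)
  have sub: "parcs (double_star k) \<subseteq> {0..<2 * (k + 1)} \<times> {0..<2 * (k + 1)}"
    by (auto simp: double_star_arcs_iff)
  have "finite (parcs (double_star k))"
    by (rule finite_subset[OF sub]) simp
  moreover have "symmetric (with_proj (double_star k))"
    unfolding symmetric_def by (auto simp: sym_def double_star_arcs_iff)
  ultimately show ?thesis
    by unfold_locales (use sub in \<open>auto simp: verts double_star_arcs_iff\<close>)
qed

lemma out_degree_double_star:
  assumes "v \<in> pverts (double_star k)"
  shows "out_degree (with_proj (double_star k)) v = (if v = 0 \<or> v = k + 1 then k + 1 else 1)"
proof -
  let ?N = "{w. (v, w) \<in> parcs (double_star k)}"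
  have "out_arcs (with_proj (double_star k)) v = Pair v ` ?N"
    by (auto simp: out_arcs_def)
  then have deg: "out_degree (with_proj (double_star k)) v = card ?N"
    by (simp add: out_degree_def card_image inj_on_def)
  have v: "v < 2 * (k + 1)"
    using assms by (simp add: double_star_def Let_def)
  consider "v = 0" | "v = k + 1" | "v \<in> {1..k}" | "v \<in> {k + 2..2 * k + 1}"
    using v by fastforce
  then show ?thesis
  proof cases
    case 1
    then have "?N = {1..k + 1}" by (auto simp: double_star_arcs_iff)
    then show ?thesis using 1 deg by simp
  next
    case 2
    then have "?N = insert 0 {k + 2..2 * k + 1}" by (auto simp: double_star_arcs_iff)
    then show ?thesis using 2 deg by simp
  next
    case 3
    then have "?N = {0}" by (auto simp: double_star_arcs_iff)
    then show ?thesis using 3 deg by simp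
  next
    case 4
    then have "?N = {k + 1}" by (auto simp: double_star_arcs_iff)
    then show ?thesis using 4 deg by simp
  qed
qed

end

theory Submission
  imports Defs
begin

text \<open>
  If a left eigenvector \<open>w\<close> of the adjacency matrix has eigenvalue \<open>\<theta>\<close>, pairing it with
  \<open>U(\<tau>) e\<^sub>a = \<gamma> e\<^sub>b\<close> gives \<open>exp (\<i> \<tau> \<theta>) w\<^sub>a = \<gamma> w\<^sub>b\<close>. For \<open>\<epsilon> = \<plusminus>1\<close> and \<open>\<theta>\<^sup>2 = \<epsilon> \<theta> + k\<close> the double
  star has an eigenvector with entries \<open>\<theta>\<close>, \<open>\<epsilon> \<theta>\<close> at the centres, so that
  \<open>exp (\<i> \<tau> \<theta>) = \<epsilon> \<gamma>\<close>. With \<open>s = sqrt (4 k + 1)\<close> the eigenvalues \<open>(1 \<plusminus> s) / 2\<close> (for \<open>\<epsilon> = 1\<close>)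
  and \<open>(s - 1) / 2\<close> (for \<open>\<epsilon> = -1\<close>) force \<open>exp (\<i> \<tau> s) = 1\<close> and \<open>exp (\<i> \<tau>) = -1\<close>. Hence \<open>s\<close> is a
  quotient of an even by an odd integer, although \<open>s\<^sup>2\<close> is odd.
\<close>

text \<open>Working with entries and a weight function \<open>w\<close> rather than with vectors
  lets the result feed directly into the entrywise series of \<open>exp_mat\<close>.\<close>

lemma left_eigenvector_pow_mat:
  fixes A :: "'a :: comm_ring_1 mat"
  assumes A: "A \<in> carrier_mat n n"
    and eig: "\<And>j. j < n \<Longrightarrow> (\<Sum>i<n. w i * A $$ (i, j)) = \<mu> * w j"
    and "j < n"
  shows "(\<Sum>i<n. w i * (A ^\<^sub>m m) $$ (i, j)) = \<mu> ^ m * w j"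
  using \<open>j < n\<close>
proof (induction m arbitrary: j)
  case 0
  have "(\<Sum>i<n. w i * (A ^\<^sub>m 0) $$ (i, j)) = (\<Sum>i<n. if i = j then w i else 0)"
    using A 0 by (intro sum.cong) auto
  then show ?case using 0 by simp
next
  case (Suc m)
  have entry: "(A ^\<^sub>m Suc m) $$ (i, j) = (\<Sum>l<n. (A ^\<^sub>m m) $$ (i, l) * A $$ (l, j))" if "i < n" for i
    using that Suc.prems A pow_carrier_mat[OF A, of m]
    by (simp add: scalar_prod_def atLeast0LessThan)
  have "(\<Sum>i<n. w i * (A ^\<^sub>m Suc m) $$ (i, j))
      = (\<Sum>i<n. \<Sum>l<n. w i * (A ^\<^sub>m m) $$ (i, l) * A $$ (l, j))"
    by (intro sum.cong refl) (simp only: entry lessThan_iff sum_distrib_left mult.assoc)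
  also have "\<dots> = (\<Sum>l<n. (\<Sum>i<n. w i * (A ^\<^sub>m m) $$ (i, l)) * A $$ (l, j))"
    by (subst sum.swap) (simp add: sum_distrib_right)
  also have "\<dots> = (\<Sum>l<n. \<mu> ^ m * (w l * A $$ (l, j)))"
    using Suc.IH by (intro sum.cong) auto
  also have "\<dots> = \<mu> ^ Suc m * w j"
    by (simp add: eig[OF Suc.prems] flip: sum_distrib_left)
  finally show ?case .
qed

text \<open>A finite weighted sum of convergent series may be taken termwise, and each term
  collapses to that of the scalar exponential series of \<open>\<mu>\<close>.\<close>

lemma left_eigenvector_exp_mat:
  assumes A: "A \<in> carrier_mat n n"
    and eig: "\<And>j. j < n \<Longrightarrow> (\<Sum>i<n. w i * A $$ (i, j)) = \<mu> * w j"
    and j: "j < n"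
  shows "(\<Sum>i<n. w i * exp_mat A $$ (i, j)) = exp \<mu> * w j"
proof -
  have "(\<lambda>m. \<Sum>i<n. w i * ((A ^\<^sub>m m) $$ (i, j) / fact m)) sums
      (\<Sum>i<n. w i * (\<Sum>m. (A ^\<^sub>m m) $$ (i, j) / fact m))"
    using summable_exp_mat[OF A _ j] by (intro sums_sum sums_mult summable_sums) auto
  also have "(\<lambda>m. \<Sum>i<n. w i * ((A ^\<^sub>m m) $$ (i, j) / fact m)) = (\<lambda>m. \<mu> ^ m /\<^sub>R fact m * w j)"
    using left_eigenvector_pow_mat[OF A eig j]
    by (auto simp: scaleR_conv_of_real field_simps simp flip: sum_divide_distrib)
  also have "(\<Sum>i<n. w i * (\<Sum>m. (A ^\<^sub>m m) $$ (i, j) / fact m)) = (\<Sum>i<n. w i * exp_mat A $$ (i, j))"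
    using A j by (intro sum.cong) (auto simp: exp_mat_def)
  finally have "(\<lambda>m. \<mu> ^ m /\<^sub>R fact m * w j) sums (\<Sum>i<n. w i * exp_mat A $$ (i, j))" .
  moreover have "(\<lambda>m. \<mu> ^ m /\<^sub>R fact m * w j) sums (exp \<mu> * w j)"
    by (intro sums_mult2 exp_converges)
  ultimately show ?thesis by (rule sums_unique2)
qed

lemma adjacency_mat_carrier: "adjacency_mat G \<in> carrier_mat (card (pverts G)) (card (pverts G))"
  by (simp add: adjacency_mat_def Let_def)

text \<open>The scalar \<open>\<gamma>\<close> is chosen before \<open>w\<close> and
  \<open>\<theta>\<close>, so one phase serves all eigenvectors; this is what makes different
  eigenvalues comparable.\<close>

lemma perfect_state_transfer_left_eigenvector:
  fixes G :: "nat pair_pre_digraph"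
  defines "n \<equiv> card (pverts G)"
  assumes "perfect_state_transfer G a b \<tau>" and a: "a < n" and b: "b < n"
  obtains \<gamma> where "\<And>w \<theta>. (\<And>j. j < n \<Longrightarrow> (\<Sum>i<n. w i * adjacency_mat G $$ (i, j)) = \<theta> * w j)
    \<Longrightarrow> exp (\<i> * complex_of_real \<tau> * \<theta>) * w a = \<gamma> * w b"
proof -
  let ?A = "(\<i> * complex_of_real \<tau>) \<cdot>\<^sub>m adjacency_mat G"
  have adj: "adjacency_mat G \<in> carrier_mat n n"
    unfolding n_def by (rule adjacency_mat_carrier)
  then have A: "?A \<in> carrier_mat n n" by simp
  then have U: "exp_mat ?A \<in> carrier_mat n n" using adj by (simp add: exp_mat_def)
  obtain \<gamma> where \<gamma>: "exp_mat ?A *\<^sub>v unit_vec n a = \<gamma> \<cdot>\<^sub>v unit_vec n b"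
    using assms(2) by (auto simp: perfect_state_transfer_def transition_mat_def n_def Let_def)
  \<comment> \<open>Column \<open>a\<close> of the transition matrix is \<open>\<gamma>\<close>
    times a unit vector, so pairing it with \<open>w\<close> leaves only
    \<open>\<gamma> * w b\<close>.\<close>
  have entry: "exp_mat ?A $$ (i, a) = (if i = b then \<gamma> else 0)" if "i < n" for i
  proof -
    have "exp_mat ?A $$ (i, a) = (exp_mat ?A *\<^sub>v unit_vec n a) $ i"
      using that a U by simp
    then show ?thesis using that b by (simp add: \<gamma>)
  qed
  have "exp (\<i> * complex_of_real \<tau> * \<theta>) * w a = \<gamma> * w b"
    if eig: "\<And>j. j < n \<Longrightarrow> (\<Sum>i<n. w i * adjacency_mat G $$ (i, j)) = \<theta> * w j" for w \<theta>
  proof -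
    have "(\<Sum>i<n. w i * ?A $$ (i, j)) = \<i> * complex_of_real \<tau> * \<theta> * w j" if "j < n" for j
    proof -
      have "(\<Sum>i<n. w i * ?A $$ (i, j)) = (\<Sum>i<n. \<i> * complex_of_real \<tau> * (w i * adjacency_mat G $$ (i, j)))"
        using adj that by (intro sum.cong) auto
      then show ?thesis by (simp add: eig[OF that] mult.assoc flip: sum_distrib_left)
    qed
    from left_eigenvector_exp_mat[OF A this a]
    have "exp (\<i> * complex_of_real \<tau> * \<theta>) * w a = (\<Sum>i<n. w i * exp_mat ?A $$ (i, a))"
      by simp
    also have "\<dots> = (\<Sum>i<n. if i = b then w i * \<gamma> else 0)"
      by (intro sum.cong) (auto simp: entry)
    finally show ?thesis using b by simp
  qed
  then show thesis by (rule that)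
qed

lemma card_pverts_double_star: "card (pverts (double_star k)) = 2 * (k + 1)"
  by (simp add: double_star_def Let_def)

text \<open>The vector is symmetric or antisymmetric under swapping the two stars, according to
  \<open>\<epsilon>\<close>. A leaf sees only its centre, which carries \<open>\<theta>\<close>
  times the leaf's entry; at a centre, \<open>k\<close> leaves and the other centre give exactly the
  quadratic condition on \<open>\<theta>\<close>.\<close>

lemma double_star_eigenvector:
  fixes \<epsilon> \<theta> :: complex
  assumes \<epsilon>: "\<epsilon>\<^sup>2 = 1" and \<theta>: "\<theta>\<^sup>2 = \<epsilon> * \<theta> + of_nat k" and j: "j < 2 * (k + 1)"
  defines "w \<equiv> \<lambda>i. (if i \<le> k then 1 else \<epsilon>) * (if i = 0 \<or> i = k + 1 then \<theta> else 1)"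
  shows "(\<Sum>i<2 * (k + 1). w i * adjacency_mat (double_star k) $$ (i, j)) = \<theta> * w j"
proof -
  let ?N = "{i. (i, j) \<in> parcs (double_star k)}"
  have "(\<Sum>i<2 * (k + 1). w i * adjacency_mat (double_star k) $$ (i, j))
      = (\<Sum>i<2 * (k + 1). if i \<in> ?N then w i else 0)"
    using j by (intro sum.cong) (auto simp: adjacency_mat_def card_pverts_double_star Let_def)
  also have "\<dots> = sum w ({..<2 * (k + 1)} \<inter> ?N)"
    by (rule sum.inter_restrict[symmetric]) simp
  also have "{..<2 * (k + 1)} \<inter> ?N = ?N"
    by (auto simp: double_star_arcs_iff)
  finally have nbr: "(\<Sum>i<2 * (k + 1). w i * adjacency_mat (double_star k) $$ (i, j)) = sum w ?N" .
  have [simp]: "\<epsilon> * \<epsilon> = 1" using \<epsilon> by (simp add: power2_eq_square)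
  have left: "sum w {1..k} = of_nat k"
    by (simp add: w_def)
  have right: "sum w {k + 2..2 * k + 1} = of_nat k * \<epsilon>"
    by (simp add: w_def)
  consider "j = 0" | "j = k + 1" | "j \<in> {1..k}" | "j \<in> {k + 2..2 * k + 1}"
    using j by fastforce
  then have "sum w ?N = \<theta> * w j"
  proof cases
    case 1
    then have "?N = insert (k + 1) {1..k}" by (auto simp: double_star_arcs_iff)
    then have "sum w ?N = w (k + 1) + sum w {1..k}" by simp
    then show ?thesis using \<theta> 1 unfolding left by (simp add: w_def power2_eq_square)
  next
    case 2
    then have "?N = insert 0 {k + 2..2 * k + 1}" by (auto simp: double_star_arcs_iff)
    then have "sum w ?N = w 0 + sum w {k + 2..2 * k + 1}" by simp
    \<comment> \<open>The quadratic condition multiplied by \<open>\<epsilon>\<close> is the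
      eigenvector equation at the second centre.\<close>
    moreover have "\<epsilon> * \<theta>\<^sup>2 = \<theta> + of_nat k * \<epsilon>" unfolding \<theta> by (simp add: algebra_simps)
    ultimately show ?thesis using 2 unfolding right by (simp add: w_def power2_eq_square mult_ac)
  next
    case 3
    then have "?N = {0}" by (auto simp: double_star_arcs_iff)
    then show ?thesis using 3 by (simp add: w_def)
  next
    case 4
    then have "?N = {k + 1}" by (auto simp: double_star_arcs_iff)
    then show ?thesis using 4 by (simp add: w_def)
  qed
  with nbr show ?thesis by simp
qed

text \<open>A parity argument: \<open>\<tau>\<close> is an odd multiple of \<open>pi\<close>, so
  otherwise squaring would equate an odd integer with an even one.\<close>

lemma cos_sqrt_odd_neq_1:
  fixes k :: nat and \<tau> :: real
  assumes "cos \<tau> = -1"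
  shows "cos (\<tau> * sqrt (4 * k + 1)) \<noteq> 1"
proof
  assume "cos (\<tau> * sqrt (4 * k + 1)) = 1"
  then obtain q :: int where q: "\<tau> * sqrt (4 * k + 1) = real_of_int q * 2 * pi"
    by (auto simp: cos_one_2pi_int)
  \<comment> \<open>The shift by \<open>pi\<close> turns the value -1 into 1, where the same
    characterisation by multiples of \<open>2 * pi\<close> applies.\<close>
  have "cos (\<tau> - pi) = 1" using assms by simp
  then obtain p :: int where "\<tau> - pi = real_of_int p * 2 * pi"
    unfolding cos_one_2pi_int by blast
  then have "\<tau> = (2 * p + 1) * pi" by (simp add: algebra_simps)
  with q have "((2 * p + 1) * sqrt (4 * k + 1)) * pi = (2 * q) * pi" by (simp add: mult_ac)
  then have "(2 * p + 1) * sqrt (4 * k + 1) = 2 * q" by (simp only: mult_cancel_right) simp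
  then have "((2 * p + 1) * sqrt (4 * k + 1))\<^sup>2 = (2 * q)\<^sup>2" by simp
  then have "real_of_int ((2 * p + 1)\<^sup>2 * (4 * int k + 1)) = real_of_int ((2 * q)\<^sup>2)"
    by (simp add: power_mult_distrib add.commute)
  then have "(2 * p + 1)\<^sup>2 * (4 * int k + 1) = (2 * q)\<^sup>2"
    by (simp only: of_int_eq_iff)
  moreover have "odd ((2 * p + 1)\<^sup>2 * (4 * int k + 1))" by simp
  ultimately show False by simp
qed

theorem lemma4p4:
  fixes k a b :: nat
  assumes "k \<ge> 1"
    and "a \<in> pverts (double_star k)" and "b \<in> pverts (double_star k)" and "a \<noteq> b"
    and "out_degree (with_proj (double_star k)) a = k + 1"
    and "out_degree (with_proj (double_star k)) b = k + 1"
  shows "\<not> (\<exists>\<tau> :: real. perfect_state_transfer (double_star k) a b \<tau>)"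
proof
  assume "\<exists>\<tau> :: real. perfect_state_transfer (double_star k) a b \<tau>"
  then obtain \<tau> :: real where pst: "perfect_state_transfer (double_star k) a b \<tau>" ..
  \<comment> \<open>Since \<open>k \<ge> 1\<close>, a leaf has degree different from
    \<open>k + 1\<close>.\<close>
  have centres: "a = 0 \<and> b = k + 1 \<or> a = k + 1 \<and> b = 0"
    using assms by (auto simp: out_degree_double_star split: if_splits)
  then have lt: "a < 2 * (k + 1)" "b < 2 * (k + 1)" by auto
  obtain \<gamma> where \<gamma>: "\<And>w \<theta>. (\<And>j. j < 2 * (k + 1) \<Longrightarrow>
      (\<Sum>i<2 * (k + 1). w i * adjacency_mat (double_star k) $$ (i, j)) = \<theta> * w j)
      \<Longrightarrow> exp (\<i> * complex_of_real \<tau> * \<theta>) * w a = \<gamma> * w b"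
    using perfect_state_transfer_left_eigenvector[OF pst] lt
    unfolding card_pverts_double_star by blast
  have phase: "cis (\<tau> * \<theta>) = of_real \<epsilon> * \<gamma>" if "\<epsilon>\<^sup>2 = 1" "\<theta>\<^sup>2 = \<epsilon> * \<theta> + k" for \<epsilon> \<theta> :: real
  proof -
    have \<epsilon>: "(complex_of_real \<epsilon>)\<^sup>2 = 1"
      using that(1) by (metis of_real_1 of_real_power)
    have \<theta>: "(complex_of_real \<theta>)\<^sup>2 = of_real \<epsilon> * of_real \<theta> + of_nat k"
      using that(2) by (metis of_real_add of_real_mult of_real_of_nat_eq of_real_power)
    \<comment> \<open>A zero root would force \<open>k = 0\<close>. Hence the centre entries can be
      cancelled; as \<open>\<epsilon>\<close> is its own inverse, both orders of the centres give
      the same phase.\<close>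
    have "\<theta> \<noteq> 0" using that(2) assms(1) by auto
    then show ?thesis
      using \<gamma>[OF double_star_eigenvector[OF \<epsilon> \<theta>]] centres \<epsilon>
      by (auto simp: cis_conv_exp power2_eq_square mult_ac)
  qed
  define s where "s = sqrt (4 * k + 1)"
  have s: "s\<^sup>2 = 4 * k + 1" by (simp add: s_def)
  have plus: "cis (\<tau> * ((1 + s) / 2)) = \<gamma>"
    using phase[of 1 "(1 + s) / 2"] s by (simp add: power2_eq_square field_simps)
  have minus: "cis (\<tau> * ((1 - s) / 2)) = \<gamma>"
    using phase[of 1 "(1 - s) / 2"] s by (simp add: power2_eq_square field_simps)
  have anti: "cis (\<tau> * ((s - 1) / 2)) = - \<gamma>"
    using phase[of "-1" "(s - 1) / 2"] s by (simp add: power2_eq_square field_simps)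
  have "\<gamma> \<noteq> 0" using plus cis_neq_zero by metis
  \<comment> \<open>Differences of eigenvalues become quotients of phases, eliminating
    \<open>\<gamma>\<close>: the symmetric pair differs by \<open>s\<close>, while
    \<open>(1 + s) / 2\<close> and the antisymmetric \<open>(s - 1) / 2\<close> differ by 1.\<close>
  have "\<tau> * s = \<tau> * ((1 + s) / 2) - \<tau> * ((1 - s) / 2)" by (simp add: field_simps)
  then have "cis (\<tau> * s) = 1"
    using plus minus \<open>\<gamma> \<noteq> 0\<close> by (metis cis_divide divide_self)
  then have "cos (\<tau> * s) = 1" by (metis cis.simps(1) one_complex.simps(1))
  have "\<tau> = \<tau> * ((1 + s) / 2) - \<tau> * ((s - 1) / 2)" by (simp add: field_simps)
  then have "cis \<tau> = \<gamma> / - \<gamma>" by (metis anti plus cis_divide)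
  then have "cos \<tau> = -1"
    using \<open>\<gamma> \<noteq> 0\<close> by (simp add: complex_eq_iff)
  then show False using cos_sqrt_odd_neq_1 \<open>cos (\<tau> * s) = 1\<close> unfolding s_def by blast
qed

end
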